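(* Let $k\ge 0$ and $r\in\{0,1,2,3\}$ be integers with $n=4k+r\ge 1$. If $n\notin\{1,2\}$, then $$\pi_{\mathrm{opt}}(S_{4,4k+r})=3k+r.$$ Moreover $\pi_{\mathrm{opt}}(S_{4,1})=2$ and $\pi_{\mathrm{opt}}(S_{4,2})=3$.
   Context: A pebbling distribution $P$ on a finite simple graph $G$ is a function $P:V(G)\to\mathbb{Z}_{\ge 0}$; its size is $|P|=\sum_{v}P(v)$. A pebbling move from a vertex $u$ having at least two pebbles to a neighbor $v$ of $u$ removes two pebbles from $u$ and adds one pebble to $v$. A vertex $v$ is reachable under $P$ if some (possibly empty) sequence of pebbling moves starting from $P$ yields a distribution with at least one pebble on $v$. $P$ is solvable if every vertex of $G$ is reachable under $P$. The optimal pebbling number $\pi_{\mathrm{opt}}(G)$ is the minimum size of a solvable distribution on $G$. Let $SG$ be the infinite square grid: vertex set $\mathbb{Z}^2$, with $(i,j)$ and $(i',j')$ adjacent iff $|i-i'|+|j-j'|=1$. For $k\in\mathbb{Z}$ let $D^+_k=\{(i,j): i-j=k\}$ (positive diagonal) and $D^-_k=\{(i,j): i+j=k\}$ (negative diagonal). For integers $n\ge 1$ and even $m$, $S_{m,n}$ is the subgraph of $SG$ induced by $\left(\bigcup_{j=1}^m D^-_j\right)\cap\left(\bigcup_{i=1}^n D^+_i\right)$. *)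

theory Defs
  imports "Graph_Theory.Pair_Digraph" "Graph_Theory.Digraph_Component"
begin

text \<open>
  Simple graphs are the loop-free symmetric digraphs of the Graph_Theory library: an undirected
  edge is a pair of opposite arcs, and \<^term>\<open>u \<rightarrow>\<^bsub>G\<^esub> v\<close> means that u and v are adjacent.
\<close>

text \<open>
  A distribution is a total function on the vertex type that vanishes outside the graph, so that
  distributions correspond one-to-one to functions from the vertex set to the naturals.
\<close>

definition pebbling_distribution :: "('a, 'b) pre_digraph \<Rightarrow> ('a \<Rightarrow> nat) \<Rightarrow> bool" where
  "pebbling_distribution G P \<longleftrightarrow> (\<forall>v. v \<notin> verts G \<longrightarrow> P v = 0)"

definition pebbling_size :: "('a, 'b) pre_digraph \<Rightarrow> ('a \<Rightarrow> nat) \<Rightarrow> nat" where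
  "pebbling_size G P = (\<Sum>v\<in>verts G. P v)"

definition pebbling_move :: "('a, 'b) pre_digraph \<Rightarrow> ('a \<Rightarrow> nat) \<Rightarrow> ('a \<Rightarrow> nat) \<Rightarrow> bool" where
  "pebbling_move G P Q \<longleftrightarrow>
     (\<exists>u v. u \<rightarrow>\<^bsub>G\<^esub> v \<and> P u \<ge> 2 \<and> Q = P(u := P u - 2, v := P v + 1))"

definition pebbling_reachable :: "('a, 'b) pre_digraph \<Rightarrow> ('a \<Rightarrow> nat) \<Rightarrow> 'a \<Rightarrow> bool" where
  "pebbling_reachable G P v \<longleftrightarrow> (\<exists>Q. (pebbling_move G)\<^sup>*\<^sup>* P Q \<and> Q v \<ge> 1)"

definition solvable :: "('a, 'b) pre_digraph \<Rightarrow> ('a \<Rightarrow> nat) \<Rightarrow> bool" where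
  "solvable G P \<longleftrightarrow> (\<forall>v\<in>verts G. pebbling_reachable G P v)"

text \<open>
  The minimum is over a nonempty set, since one pebble on every vertex is a solvable distribution;
  see \<open>ex_minimum_solvable\<close> below.  It is meant for finite graphs only.
\<close>

definition optimal_pebbling_number :: "('a, 'b) pre_digraph \<Rightarrow> nat" (\<open>\<pi>\<^sub>o\<^sub>p\<^sub>t\<close>) where
  "\<pi>\<^sub>o\<^sub>p\<^sub>t G = (LEAST s. \<exists>P. pebbling_distribution G P \<and> solvable G P \<and> pebbling_size G P = s)"

definition square_grid :: "(int \<times> int) pair_pre_digraph" where
  "square_grid =
     \<lparr> pverts = UNIV, parcs = {((i, j), (i', j')). \<bar>i - i'\<bar> + \<bar>j - j'\<bar> = 1} \<rparr>"

definition pos_diagonal :: "int \<Rightarrow> (int \<times> int) set" where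
  "pos_diagonal k = {(i, j). i - j = k}"

definition neg_diagonal :: "int \<Rightarrow> (int \<times> int) set" where
  "neg_diagonal k = {(i, j). i + j = k}"

definition staircase_graph :: "nat \<Rightarrow> nat \<Rightarrow> (int \<times> int, (int \<times> int) \<times> (int \<times> int)) pre_digraph"
  where
  "staircase_graph m n =
     with_proj square_grid \<restriction>
       ((\<Union>j\<in>{1..int m}. neg_diagonal j) \<inter> (\<Union>i\<in>{1..int n}. pos_diagonal i))"

lemma ex_minimum_solvable:
  "\<exists>P. pebbling_distribution G P \<and> solvable G P \<and> pebbling_size G P = \<pi>\<^sub>o\<^sub>p\<^sub>t G"
proof -
  let ?P = "\<lambda>v. if v \<in> verts G then 1 else (0::nat)"
  have "solvable G ?P"
    unfolding solvable_def pebbling_reachable_def by (intro ballI exI[of _ ?P]) auto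
  moreover have "pebbling_distribution G ?P"
    by (simp add: pebbling_distribution_def)
  ultimately have
    "\<exists>P. pebbling_distribution G P \<and> solvable G P \<and> pebbling_size G P = pebbling_size G ?P"
    by blast
  then show ?thesis
    unfolding optimal_pebbling_number_def by (rule LeastI)
qed

lemma verts_staircase_graph:
  "verts (staircase_graph m n) = {(i, j). i + j \<in> {1..int m} \<and> i - j \<in> {1..int n}}"
  by (auto simp: staircase_graph_def induce_subgraph_def pos_diagonal_def neg_diagonal_def)

lemma dominates_staircase_graph:
  "(i, j) \<rightarrow>\<^bsub>staircase_graph m n\<^esub> (i', j') \<longleftrightarrow>
     (i, j) \<in> verts (staircase_graph m n) \<and> (i', j') \<in> verts (staircase_graph m n) \<and>
     \<bar>i - i'\<bar> + \<bar>j - j'\<bar> = 1"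
  by (auto simp: arcs_ends_conv staircase_graph_def induce_subgraph_def square_grid_def)

lemma graph_staircase_graph: "graph (staircase_graph m n)"
proof -
  let ?S = "staircase_graph m n"
  have arcs: "arcs ?S = {(u, v). u \<rightarrow>\<^bsub>?S\<^esub> v}" "tail ?S = fst" "head ?S = snd"
    by (auto simp: arcs_ends_conv staircase_graph_def induce_subgraph_def)
  have "verts ?S \<subseteq> {-int m - int n..int m + int n} \<times> {-int m - int n..int m + int n}"
    by (auto simp: verts_staircase_graph)
  then have fin: "finite (verts ?S)"
    by (rule finite_subset) simp
  have "arcs ?S \<subseteq> verts ?S \<times> verts ?S"
    by (auto simp: staircase_graph_def induce_subgraph_def)
  then have "finite (arcs ?S)"
    using fin by (meson finite_SigmaI finite_subset)
  then show ?thesis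
    using fin
    by unfold_locales
      (auto simp: arcs arc_to_ends_def dominates_staircase_graph symmetric_def abs_minus_commute
        intro!: symI)
qed

end

theory Submission
  imports Defs
begin

text \<open>
  Sort the vertices \<open>(i, j)\<close> of \<open>S\<^bsub>4,n\<^esub>\<close> by the column
  \<open>b = i - j\<close>. There are \<open>n\<close> columns of two cells each, edges join consecutive
  columns only, and one cell of every column, the inner one, is adjacent to all cells of the neighbouring
  columns. Write \<open>f n = n - n div 4\<close>; this is \<open>3 k + r\<close> for
  \<open>n = 4 k + r\<close>, and it is the least integer that is at least \<open>3 n / 4\<close>.

  Upper bound. Two pebbles on an inner cell followed by single pebbles on the inner cells of the next
  columns form a run: the pair can be rolled along it, turning up as two pebbles in each of its columns. A
  run of at least two columns therefore reaches every cell of its columns and of the two columns next to it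
  (\<open>run_reachable\<close>). Runs of two columns cost three pebbles and serve four columns; prolonging
  the last run by one column costs one pebble and serves one column more.

  Lower bound. A cell without a pebble is reached only from a neighbouring column that can collect two
  pebbles on one cell; call such a column rich. So in a solvable distribution each column is full (has a
  pebble on both cells) or is next to a rich one (\<open>solvable_covered\<close>). What a column can
  receive is bounded by the flow \<open>l\<close> of pebbles arriving from the left when only the pebbles to
  its left are used, and the flow \<open>r\<close> from the right. Both are given by simple recursions, and
  no pebbling move can make a column rich that was not rich by this criterion before
  (\<open>rich_column_move\<close>).

  What remains is arithmetic (\<open>columns_weight_bound\<close>): the surplus \<open>4 w - 3\<close> of
  the columns, with \<open>w\<close> the number of pebbles in a column, sums to at least \<open>0\<close>.
  Consider a maximal interval of \<open>L\<close> rich columns. It contains at least \<open>L + 1\<close>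
  pebbles, so its surplus is at least \<open>L + 4\<close>. If \<open>L \<ge> 2\<close>, it can pay
  \<open>3\<close> for each of the two poor columns at its ends, which are the only poor ones that it
  serves. If \<open>L = 1\<close>, the column has to be full and rich without help, and its three or more
  pebbles can pay as well. Poor columns that are full pay for themselves. The proof counts this with a
  potential that changes from column to column, so that no intervals have to be cut out. The exceptional
  values at \<open>n = 1\<close> and \<open>n = 2\<close> exceed \<open>f n\<close> by one, and need an
  argument of their own.
\<close>

section \<open>Flow of pebbles through a column\<close>

text \<open>
  A bound for the number of pebbles that a column with \<open>x\<close> and \<open>y\<close> pebbles on its
  cells can pass on in one direction when \<open>l\<close> pebbles arrive from the other side. Two odd cells
  waste a pebble each, but a single arriving pebble can be placed so that at most one pebble is wasted in
  total.
\<close>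

fun outflow :: "nat \<times> nat \<Rightarrow> nat \<Rightarrow> nat" where
  "outflow (x, y) l = (if l = 0 then x div 2 + y div 2 else (x + y + l) div 2)"

text \<open>
  Two pebbles can meet on one cell of a column receiving \<open>s\<close> pebbles exactly if the column
  could pass a pebble on.
\<close>

definition rich :: "nat \<times> nat \<Rightarrow> nat \<Rightarrow> bool" where
  "rich p s \<longleftrightarrow> 1 \<le> outflow p s"

definition full :: "nat \<times> nat \<Rightarrow> bool" where
  "full p \<longleftrightarrow> 1 \<le> fst p \<and> 1 \<le> snd p"

definition weight :: "nat \<times> nat \<Rightarrow> nat" where
  "weight p = fst p + snd p"

lemma outflow_mono: "l \<le> l' \<Longrightarrow> outflow p l \<le> outflow p l'"
  by (cases p) (auto; presburger)

text \<open>
  Along rich columns the flows grow by less than the pebbles present. The first pebble of the flow to the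
  right is discounted (\<open>l - 1\<close> truncates at \<open>0\<close>) because of columns such as
  \<open>(2, 0)\<close>, which emit one pebble on either side for two pebbles of weight. The discount has to
  be repaid where the flow to the right dies out. A rich column of this kind is empty, and the single pebble
  coming from the left is joined there by pebbles from the right, of which at least half are lost.
\<close>

lemma rich_step:
  assumes "rich p (l + r)"
  shows "int (outflow p l - 1) - int (l - 1) + int (outflow p r) - int r \<le> int (weight p) - 1"
  using assms by (cases p) (auto simp: rich_def weight_def split: if_splits; presburger)

text \<open>
  A full rich column without inflow from the left has one more pebble to spare, if it sends at most one
  pebble to the left. This makes up for the second rich column that other intervals of rich columns have.
\<close>

lemma rich_full_step:
  assumes "rich p r" "full p" "outflow p r \<le> 1"
  shows "int (outflow p 0 - 1) + int (outflow p r) - int r \<le> int (weight p) - 2"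
  using assms by (cases p) (auto simp: rich_def weight_def full_def split: if_splits; presburger)

lemma not_rich:
  assumes "\<not> rich p (l + r)"
  shows "outflow p l = 0" "outflow p r = 0" "l + r \<le> 1"
  using assms by (cases p; auto simp: rich_def split: if_splits)+

text \<open>
  Here \<open>l b\<close> and \<open>r b\<close> are the flows into column \<open>b\<close> from the left
  and from the right, and \<open>D b\<close> says that \<open>b\<close> is a rich column. The potential
  \<open>\<phi> b\<close> belongs to the cut between the columns \<open>b\<close> and \<open>b + 1\<close>.
  After paying for the change of \<open>\<phi>\<close>, each rich column has one unit of its surplus left,
  by \<open>rich_step\<close>. So does a poor column before a rich one: there \<open>r b \<ge> 1\<close>,
  and \<open>\<phi>\<close> drops by at least \<open>4\<close>. Only a poor column before another poor one,
  or at the right end, runs a debt, of \<open>3\<close>. Unless it is full, the column before it is rich. If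
  that one is not full, the column before it is rich too, and these two follow a rich column, a poor column
  before a rich one, or the left border; so three units have been saved. A full rich column after a poor one
  saves the missing unit by \<open>rich_full_step\<close>. The savings that the neighbourhood of
  \<open>b\<close> guarantees are \<open>\<gamma> b\<close>. It remains to see that
  \<open>\<phi> + \<gamma>\<close> starts at a value at most \<open>0\<close> and ends at a value at least
  \<open>0\<close>.
\<close>

lemma columns_weight_bound:
  fixes c :: "nat \<Rightarrow> nat \<times> nat" and l r :: "nat \<Rightarrow> nat" and n :: nat
  defines "D \<equiv> \<lambda>b. 1 \<le> b \<and> b \<le> n \<and> rich (c b) (l b + r b)"
  assumes l1: "l (Suc 0) = 0" and rn: "r n = 0"
    and l_Suc: "\<And>b. 1 \<le> b \<Longrightarrow> b \<le> n \<Longrightarrow> l (Suc b) = outflow (c b) (l b)"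
    and r_pred: "\<And>b. b < n \<Longrightarrow> r b = outflow (c (Suc b)) (r (Suc b))"
    and covered: "\<And>b. 1 \<le> b \<Longrightarrow> b \<le> n \<Longrightarrow> full (c b) \<or> D (b - 1) \<or> D (Suc b)"
  shows "3 * n \<le> 4 * (\<Sum>b = 1..n. weight (c b))"
proof -
  define \<phi> :: "nat \<Rightarrow> int" where "\<phi> b = 4 * (int (l (Suc b) - 1) - int (r b))" for b
  \<comment> \<open>If column \<open>1\<close> is rich then \<open>r 0 \<ge> 1\<close>, and \<open>\<phi> 0 \<le> - 4\<close> provides the three initial units.
    A rich column that is full counts like the second rich column in a row.\<close>
  define \<gamma> :: "nat \<Rightarrow> int" where "\<gamma> b =
    (if b = 0 then (if D 1 then 3 else 0)
     else if D b then (if D (b - 1) \<or> full (c b) then 3 else 2)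
     else if D (Suc b) then 1 else 0)" for b
  have right_to_left: "1 \<le> r b" if "D (Suc b)" "l (Suc b) = 0" for b
    using that r_pred[of b] unfolding D_def rich_def by auto
  have poor_l: "l (Suc b) = 0" if "\<not> D b" "b \<le> n" for b
    using that l1 l_Suc[of b] not_rich(1)[of "c b" "l b" "r b"] by (cases b) (auto simp: D_def)
  have poor_r: "r b = 0" if "\<not> D (Suc b)" "b \<le> n" for b
    using that rn r_pred[of b] not_rich(2)[of "c (Suc b)" "l (Suc b)" "r (Suc b)"]
    by (cases "b = n") (auto simp: D_def)
  have D0: "\<not> D 0" by (simp add: D_def)
  have \<gamma>_nonneg: "0 \<le> \<gamma> b" for b by (simp add: \<gamma>_def)
  have step: "\<phi> (Suc b) + \<gamma> (Suc b) - \<phi> b - \<gamma> b \<le> 4 * int (weight (c (Suc b))) - 3"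
    if "b < n" for b
  proof (cases "D (Suc b)")
    case True
    let ?p = "c (Suc b)"
    have rich: "rich ?p (l (Suc b) + r (Suc b))" using True by (simp add: D_def)
    have \<phi>: "\<phi> (Suc b) - \<phi> b =
      4 * (int (outflow ?p (l (Suc b)) - 1) - int (l (Suc b) - 1)
          + int (outflow ?p (r (Suc b))) - int (r (Suc b)))"
      using l_Suc[of "Suc b"] r_pred[of b] that by (simp add: \<phi>_def)
    show ?thesis
    \<comment> \<open>The only steps on which \<open>\<gamma>\<close> may grow by two: a full rich column after a poor one.\<close>
    proof (cases "b \<noteq> 0 \<and> \<not> D b \<and> full ?p")
      case True': True
      then have l0: "l (Suc b) = 0" using poor_l that by simp
      have "r b \<le> 1" using True' that not_rich(3)[of "c b" "l b" "r b"] by (auto simp: D_def)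
      then have "outflow ?p (r (Suc b)) \<le> 1" using r_pred that by simp
      then have "\<phi> (Suc b) - \<phi> b \<le> 4 * (int (weight ?p) - 2)"
        using rich_full_step[of ?p "r (Suc b)"] rich True' l0 \<phi> by simp
      then show ?thesis using \<gamma>_nonneg[of b] by (simp add: \<gamma>_def split: if_splits)
    next
      case False
      have "\<phi> (Suc b) - \<phi> b \<le> 4 * (int (weight ?p) - 1)"
        using rich_step[OF rich] \<phi> by simp
      moreover have "\<gamma> (Suc b) - \<gamma> b \<le> 1"
        using False True D0 by (cases "b = 0") (auto simp: \<gamma>_def)
      ultimately show ?thesis by simp
    qed
  next
    case False
    let ?p = "c (Suc b)"
    have "r b = 0" using False poor_r that by simp
    moreover have "l (Suc b) \<le> 1"
      using False that not_rich(3)[of ?p "l (Suc b)" "r (Suc b)"] by (auto simp: D_def)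
    moreover have l0: "l (Suc (Suc b)) = 0" using False poor_l that by simp
    ultimately have \<phi>: "\<phi> (Suc b) - \<phi> b = - 4 * int (r (Suc b))" by (simp add: \<phi>_def)
    show ?thesis
    proof (cases "D (Suc (Suc b))")
      case True
      then have "1 \<le> r (Suc b)" using right_to_left l0 by simp
      moreover have "\<gamma> (Suc b) - \<gamma> b \<le> 1" using False True by (auto simp: \<gamma>_def)
      ultimately show ?thesis using \<phi> by simp
    next
      case notD: False
      then have 0: "\<gamma> (Suc b) = 0" using False by (simp add: \<gamma>_def)
      show ?thesis
      proof (cases "full ?p")
        case True
        then have "2 \<le> weight ?p" by (simp add: full_def weight_def)
        then show ?thesis using \<phi> 0 \<gamma>_nonneg[of b] by simp
      next
        case notfull: False
        then have "D b" using covered[of "Suc b"] that notD by simp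
        moreover from this have "1 \<le> b" by (simp add: D_def)
        ultimately have "\<gamma> b = 3"
          using covered[of b] False that by (auto simp: \<gamma>_def)
        then show ?thesis using \<phi> 0 by simp
      qed
    qed
  qed
  have "\<phi> m + \<gamma> m \<le> 4 * int (\<Sum>b = 1..m. weight (c b)) - 3 * int m" if "m \<le> n" for m
    using that
  proof (induction m)
    case 0
    then show ?case using l1 right_to_left[of 0] by (auto simp: \<phi>_def \<gamma>_def)
  next
    case (Suc m)
    then show ?case using step[of m] by simp
  qed
  from this[of n] have "0 \<le> 4 * int (\<Sum>b = 1..n. weight (c b)) - 3 * int n"
    using \<gamma>_nonneg[of n] rn by (simp add: \<phi>_def del: of_nat_sum)
  then show ?thesis by linarith
qed

section \<open>Flows under pebbling moves\<close>

text \<open>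
  Columns are numbered from \<open>1\<close> to \<open>n\<close>, and the columns \<open>0\<close> and
  \<open>n + 1\<close> serve as empty borders. The flow from the right is the flow from the left of the
  mirrored row of columns.
\<close>

primrec inflow :: "(nat \<Rightarrow> nat \<times> nat) \<Rightarrow> nat \<Rightarrow> nat" where
  "inflow c 0 = 0"
| "inflow c (Suc b) = outflow (c b) (inflow c b)"

definition mirror :: "nat \<Rightarrow> (nat \<Rightarrow> 'a) \<Rightarrow> nat \<Rightarrow> 'a" where
  "mirror n c b = c (Suc n - b)"

definition inflow_right :: "nat \<Rightarrow> (nat \<Rightarrow> nat \<times> nat) \<Rightarrow> nat \<Rightarrow> nat" where
  "inflow_right n c b = inflow (mirror n c) (Suc n - b)"

fun minus_two :: "nat \<times> nat \<Rightarrow> nat \<times> nat \<Rightarrow> bool" where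
  "minus_two (x, y) (x', y') \<longleftrightarrow> x = x' + 2 \<and> y = y' \<or> x = x' \<and> y = y' + 2"

fun plus_one :: "nat \<times> nat \<Rightarrow> nat \<times> nat \<Rightarrow> bool" where
  "plus_one (x, y) (x', y') \<longleftrightarrow> x' = x + 1 \<and> y' = y \<or> x' = x \<and> y' = y + 1"

definition column_move ::
  "nat \<Rightarrow> nat \<Rightarrow> (nat \<Rightarrow> nat \<times> nat) \<Rightarrow> (nat \<Rightarrow> nat \<times> nat) \<Rightarrow> bool" where
  "column_move s t c c' \<longleftrightarrow> minus_two (c s) (c' s) \<and> plus_one (c t) (c' t) \<and>
     (\<forall>b. b \<noteq> s \<longrightarrow> b \<noteq> t \<longrightarrow> c' b = c b)"

text \<open>
  The next four facts say how a move changes the outflow of its source and its target. The source loses one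
  unit of outflow, and one more arriving pebble gains at most this unit back. At the target, the new pebble
  adds at most one unit, and it is worth no more than one that is still to arrive.
\<close>

lemma outflow_minus_two: "minus_two p p' \<Longrightarrow> outflow p' l + 1 = outflow p l"
  by (cases p; cases p') auto

lemma outflow_minus_two_Suc: "minus_two p p' \<Longrightarrow> outflow p' (Suc l) \<le> outflow p l"
  by (cases p; cases p') (auto; presburger)

lemma outflow_plus_one: "plus_one p p' \<Longrightarrow> outflow p' l \<le> outflow p l + 1"
  by (cases p; cases p') auto

lemma outflow_plus_one_Suc: "plus_one p p' \<Longrightarrow> outflow p' l \<le> outflow p (Suc l)"
  by (cases p; cases p') (auto; presburger)

text \<open>
  A move to the right only carries out a part of the flow to the right: the target column expects one pebble
  less, and it already has that pebble.
\<close>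

lemma inflow_move_away:
  assumes "column_move s (Suc s) c c'"
  shows "inflow c' b + (if b = Suc s then 1 else 0) \<le> inflow c b"
proof (induction b)
  case 0
  then show ?case by simp
next
  case (Suc b)
  consider "b = s" | "b = Suc s" | "b \<noteq> s" "b \<noteq> Suc s" by blast
  then show ?case
  proof cases
    case 1
    have "outflow (c' b) (inflow c' b) \<le> outflow (c' b) (inflow c b)"
      using Suc 1 by (intro outflow_mono) simp
    then show ?thesis using assms 1 outflow_minus_two[of "c b" "c' b" "inflow c b"]
      by (simp add: column_move_def)
  next
    case 2
    have "outflow (c' b) (inflow c' b) \<le> outflow (c b) (Suc (inflow c' b))"
      using assms 2 by (intro outflow_plus_one_Suc) (simp add: column_move_def)
    also have "\<dots> \<le> outflow (c b) (inflow c b)"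
      using Suc 2 by (intro outflow_mono) simp
    finally show ?thesis using 2 by simp
  next
    case 3
    then show ?thesis using assms Suc by (simp add: column_move_def outflow_mono)
  qed
qed

text \<open>
  A move to the left adds at most one pebble to the flow out of its target. It cannot reach beyond the
  source, which has lost two pebbles.
\<close>

lemma inflow_move_towards:
  assumes "column_move (Suc t) t c c'"
  shows "inflow c' b \<le> inflow c b + (if b = Suc t then 1 else 0)"
proof (induction b)
  case 0
  then show ?case by simp
next
  case (Suc b)
  consider "b = t" | "b = Suc t" | "b \<noteq> t" "b \<noteq> Suc t" by blast
  then show ?case
  proof cases
    case 1
    have "outflow (c' b) (inflow c' b) \<le> outflow (c' b) (inflow c b)"
      using Suc 1 by (intro outflow_mono) simp
    then show ?thesis using assms 1 outflow_plus_one[of "c b" "c' b" "inflow c b"]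
      by (simp add: column_move_def)
  next
    case 2
    have "outflow (c' b) (inflow c' b) \<le> outflow (c' b) (Suc (inflow c b))"
      using Suc 2 by (intro outflow_mono) simp
    also have "\<dots> \<le> outflow (c b) (inflow c b)"
      using assms 2 by (intro outflow_minus_two_Suc) (simp add: column_move_def)
    finally show ?thesis using 2 by simp
  next
    case 3
    then show ?thesis using assms Suc by (simp add: column_move_def outflow_mono)
  qed
qed

lemma column_move_mirror:
  assumes "column_move s t c c'" "1 \<le> s" "s \<le> n" "1 \<le> t" "t \<le> n"
  shows "column_move (Suc n - s) (Suc n - t) (mirror n c) (mirror n c')"
proof -
  have "Suc n - b \<noteq> s" if "b \<noteq> Suc n - s" for b using that assms by arith
  moreover have "Suc n - b \<noteq> t" if "b \<noteq> Suc n - t" for b using that assms by arith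
  ultimately show ?thesis using assms by (auto simp: column_move_def mirror_def)
qed

definition rich_column :: "nat \<Rightarrow> (nat \<Rightarrow> nat \<times> nat) \<Rightarrow> nat \<Rightarrow> bool" where
  "rich_column n c b \<longleftrightarrow> rich (c b) (inflow c b + inflow_right n c b)"

lemma rich_mono: "rich p s \<Longrightarrow> s \<le> s' \<Longrightarrow> rich p s'"
  using outflow_mono[of s s' p] by (simp add: rich_def)

lemma rich_plus_one: "plus_one p p' \<Longrightarrow> rich p' s \<Longrightarrow> Suc s \<le> s' \<Longrightarrow> rich p s'"
  using outflow_plus_one_Suc[of p p' s] outflow_mono[of "Suc s" s' p] by (simp add: rich_def)

lemma rich_minus_two: "minus_two p p' \<Longrightarrow> rich p s"
  using outflow_minus_two[of p p' s] by (simp add: rich_def)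

text \<open>
  At the source column two pebbles were together before the move, so it was rich. At the target the
  additional pebble is compensated by a smaller inflow, and elsewhere neither flow has grown.
\<close>

lemma rich_column_move:
  assumes move: "column_move s t c c'" and adj: "s = Suc t \<or> t = Suc s"
    and range: "1 \<le> s" "s \<le> n" "1 \<le> t" "t \<le> n" and b: "b \<le> n"
    and rich: "rich_column n c' b"
  shows "rich_column n c b"
proof -
  note mirrored = column_move_mirror[OF move range]
  have "inflow c' b + inflow_right n c' b + (if b = t then 1 else 0)
    \<le> inflow c b + inflow_right n c b" if "b \<noteq> s"
    using adj
  proof
    assume s: "s = Suc t"
    have "inflow (mirror n c') (Suc n - b) + (if b = t then 1 else 0)
      \<le> inflow (mirror n c) (Suc n - b)"
      using inflow_move_away[of "n - t" "mirror n c" "mirror n c'" "Suc n - b"] mirrored s range b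
      by (auto simp: Suc_diff_le split: if_splits)
    then show ?thesis
      using inflow_move_towards[of t c c' b] move that s by (simp add: inflow_right_def)
  next
    assume t: "t = Suc s"
    have "inflow (mirror n c') (Suc n - b) \<le> inflow (mirror n c) (Suc n - b)"
      using inflow_move_towards[of "n - s" "mirror n c" "mirror n c'" "Suc n - b"] mirrored t range b that
      by (auto simp: Suc_diff_le split: if_splits)
    then show ?thesis
      using inflow_move_away[of s c c' b] move t by (simp add: inflow_right_def split: if_splits)
  qed
  then show ?thesis
    using rich move rich_minus_two[of "c s" "c' s"] rich_mono[of "c b"] rich_plus_one[of "c t" "c' t"]
    unfolding rich_column_def column_move_def by (cases "b = s"; cases "b = t") fastforce+
qed


section \<open>The columns of the graph\<close>

text \<open>
  The cells of column \<open>b\<close> are its vertices with \<open>i + j \<in> {1, 3}\<close> for odd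
  \<open>b\<close>, and with \<open>i + j \<in> {2, 4}\<close> for even \<open>b\<close>.
\<close>

definition lower :: "nat \<Rightarrow> int \<times> int" where
  "lower b = (int (b div 2) + 1, int (b div 2) + 1 - int b)"

definition upper :: "nat \<Rightarrow> int \<times> int" where
  "upper b = (int (b div 2) + 2, int (b div 2) + 2 - int b)"

definition columns :: "(int \<times> int \<Rightarrow> nat) \<Rightarrow> nat \<Rightarrow> nat \<times> nat" where
  "columns P b = (P (lower b), P (upper b))"

lemma cell_inject [simp]:
  "lower b = lower b' \<longleftrightarrow> b = b'" "upper b = upper b' \<longleftrightarrow> b = b'"
  "lower b \<noteq> upper b'" "upper b' \<noteq> lower b"
  by (auto simp: lower_def upper_def)

lemma verts_cells:
  "v \<in> verts (staircase_graph 4 n) \<longleftrightarrow> (\<exists>b. 1 \<le> b \<and> b \<le> n \<and> (v = lower b \<or> v = upper b))"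
proof
  assume "v \<in> verts (staircase_graph 4 n)"
  moreover obtain i j where v: "v = (i, j)" by (cases v)
  ultimately have ij: "i + j \<in> {1..4}" "i - j \<in> {1..int n}" by (auto simp: verts_staircase_graph)
  define b where "b = nat (i - j)"
  have b: "int b = i - j" "1 \<le> b" "b \<le> n" using ij by (auto simp: b_def)
  then have "int (b div 2) = (i - j) div 2" by (simp add: zdiv_int)
  then have "i = int (b div 2) + 1 \<or> i = int (b div 2) + 2"
    using ij(1) by simp presburger
  then have "v = lower b \<or> v = upper b" using b(1) v by (auto simp: lower_def upper_def)
  then show "\<exists>b. 1 \<le> b \<and> b \<le> n \<and> (v = lower b \<or> v = upper b)" using b by blast
next
  assume "\<exists>b. 1 \<le> b \<and> b \<le> n \<and> (v = lower b \<or> v = upper b)"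
  then show "v \<in> verts (staircase_graph 4 n)"
    by (auto simp: lower_def upper_def verts_staircase_graph; presburger)
qed

lemma dominates_cells:
  assumes "u \<rightarrow>\<^bsub>staircase_graph 4 n\<^esub> v" "u \<in> {lower s, upper s}" "v \<in> {lower t, upper t}"
  shows "s = Suc t \<or> t = Suc s"
proof -
  have "\<bar>fst u - fst v\<bar> + \<bar>snd u - snd v\<bar> = 1"
    using assms(1) dominates_staircase_graph[of "fst u" "snd u" "fst v" "snd v" 4 n] by simp
  moreover have "fst u - snd u = int s" "fst v - snd v = int t"
    using assms(2,3) by (auto simp: lower_def upper_def)
  ultimately show ?thesis by arith
qed

lemma pebbling_move_columns:
  assumes "pebbling_move (staircase_graph 4 n) P Q"
  obtains s t where "column_move s t (columns P) (columns Q)" "s = Suc t \<or> t = Suc s"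
    "1 \<le> s" "s \<le> n" "1 \<le> t" "t \<le> n"
proof -
  obtain u v where uv: "u \<rightarrow>\<^bsub>staircase_graph 4 n\<^esub> v" "P u \<ge> 2" "Q = P(u := P u - 2, v := P v + 1)"
    using assms unfolding pebbling_move_def by blast
  then have "u \<in> verts (staircase_graph 4 n)" "v \<in> verts (staircase_graph 4 n)"
    using dominates_staircase_graph[of "fst u" "snd u" "fst v" "snd v" 4 n] by auto
  then obtain s t where st: "u \<in> {lower s, upper s}" "v \<in> {lower t, upper t}"
    "1 \<le> s" "s \<le> n" "1 \<le> t" "t \<le> n"
    unfolding verts_cells by blast
  note adj = dominates_cells[OF uv(1) st(1,2)]
  then have "s \<noteq> t" by auto
  moreover have "u = lower s \<or> u = upper s" "v = lower t \<or> v = upper t" using st(1,2) by simp_all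
  ultimately have "column_move s t (columns P) (columns Q)"
    using uv(2) unfolding column_move_def columns_def uv(3) by (elim disjE) simp_all
  then show thesis using that st adj by blast
qed

lemma rich_column_reachable:
  assumes "(pebbling_move (staircase_graph 4 n))\<^sup>*\<^sup>* P Q" "b \<le> n" "rich_column n (columns Q) b"
  shows "rich_column n (columns P) b"
  using assms
proof (induction rule: converse_rtranclp_induct)
  case base
  then show ?case by simp
next
  case (step P P')
  from step.hyps(1) show ?case
  proof (rule pebbling_move_columns)
    fix s t assume "column_move s t (columns P) (columns P')" "s = Suc t \<or> t = Suc s"
      "1 \<le> s" "s \<le> n" "1 \<le> t" "t \<le> n"
    then show ?thesis
      by (rule rich_column_move) (use step.IH step.prems in auto)
  qed
qed

lemma reachable_from_neighbor:
  assumes "pebbling_reachable G P v" "P v = 0"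
  obtains Q u where "(pebbling_move G)\<^sup>*\<^sup>* P Q" "u \<rightarrow>\<^bsub>G\<^esub> v" "Q u \<ge> 2"
proof -
  obtain Q where "(pebbling_move G)\<^sup>*\<^sup>* P Q" "Q v \<ge> 1"
    using assms(1) unfolding pebbling_reachable_def by blast
  then have "\<exists>Q u. (pebbling_move G)\<^sup>*\<^sup>* P Q \<and> u \<rightarrow>\<^bsub>G\<^esub> v \<and> Q u \<ge> 2"
  proof (induction rule: rtranclp_induct)
    case base
    then show ?case using assms(2) by simp
  next
    case (step Q R)
    obtain u w where uw: "u \<rightarrow>\<^bsub>G\<^esub> w" "Q u \<ge> 2" "R = Q(u := Q u - 2, w := Q w + 1)"
      using step.hyps(2) unfolding pebbling_move_def by blast
    show ?case
    proof (cases "w = v")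
      case True
      then show ?thesis using uw(1,2) step.hyps(1) by blast
    next
      case False
      then have "R v \<le> Q v" by (simp add: uw(3))
      then have "Q v \<ge> 1" using step.prems by linarith
      then show ?thesis by (rule step.IH)
    qed
  qed
  then show thesis using that by blast
qed

text \<open>
  The first move onto a cell that is empty at first starts from two pebbles on a cell of a neighbouring
  column. That column is rich at this moment, hence it has been rich from the beginning.
\<close>

lemma solvable_covered:
  assumes "solvable (staircase_graph 4 n) P" "1 \<le> b" "b \<le> n" "\<not> full (columns P b)"
  obtains t where "1 \<le> t" "t \<le> n" "b = Suc t \<or> t = Suc b" "rich_column n (columns P) t"
proof -
  let ?G = "staircase_graph 4 n"
  have "P (lower b) = 0 \<or> P (upper b) = 0"
    using assms(4) unfolding full_def columns_def by simp linarith
  then obtain v where v: "v \<in> {lower b, upper b}" "P v = 0" by blast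
  then have "v \<in> verts ?G" using assms(2,3) unfolding verts_cells by auto
  then have "pebbling_reachable ?G P v" using assms(1) unfolding solvable_def by blast
  then obtain Q u where Q: "(pebbling_move ?G)\<^sup>*\<^sup>* P Q" "u \<rightarrow>\<^bsub>?G\<^esub> v" "Q u \<ge> 2"
    using v(2) by (rule reachable_from_neighbor)
  then have "u \<in> verts ?G"
    using dominates_staircase_graph[of "fst u" "snd u" "fst v" "snd v" 4 n] by auto
  then obtain t where t: "1 \<le> t" "t \<le> n" "u \<in> {lower t, upper t}" by (auto simp: verts_cells)
  have "rich_column n (columns Q) t"
    using t(3) Q(3) by (auto simp: rich_column_def rich_def columns_def)
  then have "rich_column n (columns P) t" using rich_column_reachable Q(1) t(2) by blast
  then show thesis using that t dominates_cells[OF Q(2) t(3) v(1)] by blast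
qed

section \<open>Lower bounds\<close>

lemma pebbling_size_columns:
  "pebbling_size (staircase_graph 4 n) P = (\<Sum>b = 1..n. weight (columns P b))"
proof -
  have "verts (staircase_graph 4 n) = lower ` {1..n} \<union> upper ` {1..n}"
    by (rule set_eqI, unfold verts_cells) auto
  then have "pebbling_size (staircase_graph 4 n) P = sum P (lower ` {1..n}) + sum P (upper ` {1..n})"
    unfolding pebbling_size_def by (subst sum.union_disjoint[symmetric]) auto
  also have "\<dots> = (\<Sum>b = 1..n. P (lower b)) + (\<Sum>b = 1..n. P (upper b))"
    by (simp add: sum.reindex inj_on_def)
  finally show ?thesis by (simp add: weight_def columns_def sum.distrib)
qed

lemma columns_outside:
  assumes "pebbling_distribution (staircase_graph 4 n) P" "b = 0 \<or> n < b"
  shows "columns P b = (0, 0)"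
proof -
  have "lower b \<notin> verts (staircase_graph 4 n)" "upper b \<notin> verts (staircase_graph 4 n)"
    using assms(2) by (auto simp: verts_cells)
  then show ?thesis using assms(1) unfolding columns_def pebbling_distribution_def by metis
qed


lemma solvable_size_ge:
  assumes "pebbling_distribution (staircase_graph 4 n) P" "solvable (staircase_graph 4 n) P"
  shows "3 * n \<le> 4 * pebbling_size (staircase_graph 4 n) P"
proof -
  let ?c = "columns P"
  have c0: "?c 0 = (0, 0)" "?c (Suc n) = (0, 0)" using columns_outside[OF assms(1)] by auto
  show ?thesis
    unfolding pebbling_size_columns
  proof (rule columns_weight_bound[where l = "inflow ?c" and r = "inflow_right n ?c"])
    show "inflow ?c (Suc 0) = 0" using c0 by simp
    show "inflow_right n ?c n = 0" using c0 by (simp add: inflow_right_def mirror_def)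
    show "inflow ?c (Suc b) = outflow (?c b) (inflow ?c b)" for b by simp
    show "inflow_right n ?c b = outflow (?c (Suc b)) (inflow_right n ?c (Suc b))" if "b < n" for b
    proof -
      have "Suc n - b = Suc (n - b)" using that by simp
      then show ?thesis using that by (simp add: inflow_right_def mirror_def)
    qed
    fix b assume b: "1 \<le> b" "b \<le> n"
    then show "full (?c b) \<or>
      (1 \<le> b - 1 \<and> b - 1 \<le> n \<and> rich (?c (b - 1)) (inflow ?c (b - 1) + inflow_right n ?c (b - 1))) \<or>
      (1 \<le> Suc b \<and> Suc b \<le> n \<and> rich (?c (Suc b)) (inflow ?c (Suc b) + inflow_right n ?c (Suc b)))"
      using solvable_covered[OF assms(2) b] unfolding rich_column_def by (metis diff_Suc_1)
  qed
qed

lemma solvable_size_ge_1: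
  assumes "solvable (staircase_graph 4 1) P"
  shows "2 \<le> pebbling_size (staircase_graph 4 1) P"
proof -
  have "full (columns P 1)"
    using solvable_covered[OF assms, of 1] by fastforce
  then show ?thesis by (simp add: pebbling_size_columns full_def weight_def)
qed

text \<open>
  Two pebbles do not suffice in two columns. If one column is full, then it has them all, and they cannot
  move. Otherwise each column is rich with the help of the other one, which contributes at most half of its
  pebbles; adding both conditions shows that three pebbles are needed.
\<close>

lemma solvable_size_ge_2:
  assumes "pebbling_distribution (staircase_graph 4 2) P" "solvable (staircase_graph 4 2) P"
  shows "3 \<le> pebbling_size (staircase_graph 4 2) P"
proof (rule ccontr)
  obtain x y z w where c: "columns P 1 = (x, y)" "columns P 2 = (z, w)" by (meson surj_pair)
  have c0: "columns P 0 = (0, 0)" "columns P 3 = (0, 0)" using columns_outside[OF assms(1)] by auto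
  have size: "pebbling_size (staircase_graph 4 2) P = x + y + (z + w)"
    using c by (simp add: pebbling_size_columns weight_def numeral_2_eq_2)
  have "rich_column 2 (columns P) 2 \<longleftrightarrow> rich (z, w) (outflow (x, y) 0)"
    using c c0 by (simp add: rich_column_def inflow_right_def mirror_def numeral_2_eq_2 numeral_3_eq_3)
  moreover have "full (columns P 1) \<or> rich_column 2 (columns P) 2"
    using solvable_covered[OF assms(2), of 1]
    by (metis One_nat_def Suc_1 diff_Suc_1 not_one_le_zero one_le_numeral order_refl)
  ultimately have one: "full (x, y) \<or> rich (z, w) (outflow (x, y) 0)" using c by simp
  have "rich_column 2 (columns P) 1 \<longleftrightarrow> rich (x, y) (outflow (z, w) 0)"
    using c c0 by (simp add: rich_column_def inflow_right_def mirror_def numeral_2_eq_2 numeral_3_eq_3)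
  moreover have "full (columns P 2) \<or> rich_column 2 (columns P) 1"
    using solvable_covered[OF assms(2), of 2]
    by (metis One_nat_def Suc_1 Suc_inject Suc_n_not_le_n le_refl one_le_numeral)
  ultimately have two: "full (z, w) \<or> rich (x, y) (outflow (z, w) 0)" using c by simp
  assume "\<not> ?thesis"
  then have small: "x + y + (z + w) \<le> 2" using size by simp
  have "\<not> full (x, y)"
  proof
    assume "full (x, y)"
    then have "x = 1" "y = 1" "z = 0" "w = 0" using small by (auto simp: full_def)
    then show False using two by (simp add: full_def rich_def)
  qed
  moreover have "\<not> full (z, w)"
  proof
    assume "full (z, w)"
    then have "x = 0" "y = 0" "z = 1" "w = 1" using small by (auto simp: full_def)
    then show False using one by (simp add: full_def rich_def)
  qed
  moreover have "2 \<le> p + q + s" if "rich (p, q) s" for p q s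
    using that by (auto simp: rich_def split: if_splits)
  moreover have "2 * outflow (p, q) 0 \<le> p + q" for p q by simp
  ultimately have "2 \<le> z + w + outflow (x, y) 0" "2 \<le> x + y + outflow (z, w) 0"
    "2 * outflow (x, y) 0 \<le> x + y" "2 * outflow (z, w) 0 \<le> z + w"
    using one two by blast+
  then show False using small by linarith
qed

section \<open>Solvable distributions made of runs\<close>

definition inner :: "nat \<Rightarrow> int \<times> int" where
  "inner b = (if odd b then upper b else lower b)"

lemma inner_dominates:
  assumes "1 \<le> t" "t \<le> n" "1 \<le> b" "b \<le> n" "t = Suc b \<or> b = Suc t" "v \<in> {lower b, upper b}"
  shows "inner t \<rightarrow>\<^bsub>staircase_graph 4 n\<^esub> v"
proof -
  have "inner t \<in> verts (staircase_graph 4 n)" "v \<in> verts (staircase_graph 4 n)"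
    using assms unfolding verts_cells inner_def by auto
  moreover have "\<bar>fst (inner t) - fst v\<bar> + \<bar>snd (inner t) - snd v\<bar> = 1"
    using assms(5,6) by (elim disjE insertE emptyE; cases "even b";
      auto simp: inner_def lower_def upper_def elim!: oddE evenE; presburger)
  ultimately show ?thesis
    using dominates_staircase_graph[of "fst (inner t)" "snd (inner t)" "fst v" "snd v" 4 n] by simp
qed

lemma inner_inject [simp]: "inner b = inner b' \<longleftrightarrow> b = b'"
  by (auto simp: inner_def)

lemma pebbling_moveI:
  "u \<rightarrow>\<^bsub>G\<^esub> v \<Longrightarrow> P u \<ge> 2 \<Longrightarrow> pebbling_move G P (P(u := P u - 2, v := P v + 1))"
  unfolding pebbling_move_def by blast

text \<open>
  The pair of pebbles at the start of a run becomes one pebble on the next inner cell, where it finds a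
  second one.
\<close>

lemma run_move_two:
  assumes "1 \<le> s" "s \<le> t" "t \<le> e" "e \<le> n" "P (inner s) \<ge> 2" "\<forall>j. s < j \<and> j \<le> e \<longrightarrow> P (inner j) \<ge> 1"
  shows "\<exists>Q. (pebbling_move (staircase_graph 4 n))\<^sup>*\<^sup>* P Q \<and> Q (inner t) \<ge> 2 \<and>
    (\<forall>j. t < j \<and> j \<le> e \<longrightarrow> Q (inner j) \<ge> 1)"
  using assms(2,3)
proof (induction t rule: dec_induct)
  case base
  then show ?case using assms by blast
next
  case (step t)
  let ?G = "staircase_graph 4 n"
  obtain Q where Q: "(pebbling_move ?G)\<^sup>*\<^sup>* P Q" "Q (inner t) \<ge> 2"
    "\<forall>j. t < j \<and> j \<le> e \<longrightarrow> Q (inner j) \<ge> 1"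
    using step by auto
  let ?R = "Q(inner t := Q (inner t) - 2, inner (Suc t) := Q (inner (Suc t)) + 1)"
  have "inner t \<rightarrow>\<^bsub>?G\<^esub> inner (Suc t)"
    using assms(1,4) step.hyps step.prems
    by (intro inner_dominates[where b = "Suc t"]) (auto simp: inner_def)
  then have "(pebbling_move ?G)\<^sup>*\<^sup>* P ?R"
    using Q(1,2) by (meson pebbling_moveI rtranclp.rtrancl_into_rtrancl)
  moreover have "?R (inner (Suc t)) \<ge> 2" using Q(3) step.prems by simp
  moreover have "\<forall>j. Suc t < j \<and> j \<le> e \<longrightarrow> ?R (inner j) \<ge> 1" using Q(3) by simp
  ultimately show ?case by blast
qed

text \<open>
  A run of at least two columns has a column next to any column that it meets or borders on, which is why
  \<open>s < e\<close> is needed: two pebbles on a single inner cell do not reach the other cell of its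
  column.
\<close>

lemma run_reachable:
  assumes "1 \<le> s" "s < e" "e \<le> n" "P (inner s) \<ge> 2" "\<forall>j. s < j \<and> j \<le> e \<longrightarrow> P (inner j) \<ge> 1"
    and "1 \<le> b" "b \<le> n" "s \<le> Suc b" "b \<le> Suc e" "v \<in> {lower b, upper b}"
  shows "pebbling_reachable (staircase_graph 4 n) P v"
proof -
  let ?G = "staircase_graph 4 n"
  define t where "t = (if b \<le> s then Suc b else b - 1)"
  have t: "s \<le> t" "t \<le> e" "t = Suc b \<or> b = Suc t" using assms by (auto simp: t_def)
  then obtain Q where Q: "(pebbling_move ?G)\<^sup>*\<^sup>* P Q" "Q (inner t) \<ge> 2"
    using run_move_two[of s t e n P] assms by auto
  let ?R = "Q(inner t := Q (inner t) - 2, v := Q v + 1)"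
  have "inner t \<rightarrow>\<^bsub>?G\<^esub> v" using t assms by (intro inner_dominates[where b = b]) auto
  then have "(pebbling_move ?G)\<^sup>*\<^sup>* P ?R"
    using Q by (meson pebbling_moveI rtranclp.rtrancl_into_rtrancl)
  then show ?thesis unfolding pebbling_reachable_def by (intro exI[of _ ?R]) simp
qed

definition inner_distribution :: "nat \<Rightarrow> (nat \<Rightarrow> nat) \<Rightarrow> int \<times> int \<Rightarrow> nat" where
  "inner_distribution n f v = (\<Sum>b | 1 \<le> b \<and> b \<le> n \<and> inner b = v. f b)"

lemma inner_distribution_inner:
  "1 \<le> b \<Longrightarrow> b \<le> n \<Longrightarrow> inner_distribution n f (inner b) = f b"
proof -
  assume "1 \<le> b" "b \<le> n"
  then have "{b'. 1 \<le> b' \<and> b' \<le> n \<and> inner b' = inner b} = {b}" by auto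
  then show ?thesis by (simp add: inner_distribution_def)
qed

lemma pebbling_distribution_inner: "pebbling_distribution (staircase_graph 4 n) (inner_distribution n f)"
  unfolding pebbling_distribution_def
proof (intro allI impI)
  fix v assume "v \<notin> verts (staircase_graph 4 n)"
  then have "{b. 1 \<le> b \<and> b \<le> n \<and> inner b = v} = {}"
    unfolding verts_cells inner_def by auto
  then show "inner_distribution n f v = 0" unfolding inner_distribution_def by (simp only: sum.empty)
qed

lemma pebbling_size_inner:
  "pebbling_size (staircase_graph 4 n) (inner_distribution n f) = (\<Sum>b = 1..n. f b)"
proof -
  have "weight (columns (inner_distribution n f) b) = f b" if "b \<in> {1..n}" for b
  proof -
    have "{b'. 1 \<le> b' \<and> b' \<le> n \<and> inner b' = (if odd b then lower b else upper b)} = {}"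
      by (auto simp: inner_def)
    then have "inner_distribution n f (if odd b then lower b else upper b) = 0"
      by (simp only: inner_distribution_def) simp
    then show ?thesis
      using inner_distribution_inner[of b n f] that
      by (auto simp: weight_def columns_def inner_def split: if_splits)
  qed
  then show ?thesis by (simp add: pebbling_size_columns)
qed

lemma solvable_of_runs:
  assumes "\<And>b. 1 \<le> b \<Longrightarrow> b \<le> n \<Longrightarrow> \<exists>s e. 1 \<le> s \<and> s < e \<and> e \<le> n \<and> s \<le> Suc b \<and> b \<le> Suc e \<and>
    f s \<ge> 2 \<and> (\<forall>j. s < j \<and> j \<le> e \<longrightarrow> f j \<ge> 1)"
  shows "solvable (staircase_graph 4 n) (inner_distribution n f)"
  unfolding solvable_def
proof
  fix v assume "v \<in> verts (staircase_graph 4 n)"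
  then obtain b where b: "1 \<le> b" "b \<le> n" "v \<in> {lower b, upper b}" by (auto simp: verts_cells)
  then obtain s e where se: "1 \<le> s" "s < e" "e \<le> n" "s \<le> Suc b" "b \<le> Suc e" "f s \<ge> 2"
    "\<forall>j. s < j \<and> j \<le> e \<longrightarrow> f j \<ge> 1"
    using assms[of b] by auto
  have "inner_distribution n f (inner s) \<ge> 2"
    using se by (simp add: inner_distribution_inner)
  moreover have "\<forall>j. s < j \<and> j \<le> e \<longrightarrow> inner_distribution n f (inner j) \<ge> 1"
    using se by (simp add: inner_distribution_inner)
  ultimately show "pebbling_reachable (staircase_graph 4 n) (inner_distribution n f) v"
    using run_reachable[OF se(1-3)] b se(4,5) by blast
qed

text \<open>
  There are \<open>(n + 1) div 4\<close> runs, which occupy the columns \<open>4 i + 2\<close> and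
  \<open>4 i + 3\<close>. If \<open>n mod 4\<close> is \<open>1\<close> or \<open>2\<close>, the last one is
  prolonged up to column \<open>n - 1\<close>. If \<open>n mod 4 = 3\<close>, the last block of four columns
  is cut off after its third column.
\<close>

definition runs :: "nat \<Rightarrow> nat \<Rightarrow> nat" where
  "runs n b = (if 4 * (Suc n div 4) \<le> b then of_bool (b < n)
     else if b mod 4 = 2 then 2 else of_bool (b mod 4 = 3))"

lemma solvable_runs:
  assumes "3 \<le> n"
  shows "solvable (staircase_graph 4 n) (inner_distribution n (runs n))"
proof (rule solvable_of_runs)
  fix b assume b: "1 \<le> b" "b \<le> n"
  define m where "m = Suc n div 4"
  have m: "1 \<le> m" "4 * m \<le> Suc n" "Suc n \<le> 4 * m + 3" using assms by (auto simp: m_def)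
  \<comment> \<open>The run of the block of four columns containing \<open>b\<close>; the last run for the columns behind all blocks.\<close>
  define i where "i = min ((b - 1) div 4) (m - 1)"
  define s where "s = 4 * i + 2"
  define e where "e = (if i = m - 1 then max (Suc s) (n - 1) else Suc s)"
  have "4 * Suc i \<le> 4 * m" using m by (simp add: i_def)
  then have i: "4 * i + 4 \<le> 4 * m" by simp
  have run: "runs n j \<ge> 1" if "s < j" "j \<le> e" for j
  proof (cases "4 * m \<le> j")
    case True
    then have "j < n" using that m i by (auto simp: e_def s_def split: if_splits)
    then show ?thesis using True by (simp add: runs_def m_def)
  next
    case False
    then have "j = 4 * i + 3" using that m i by (auto simp: e_def s_def split: if_splits)
    then have "j mod 4 = 3" by presburger
    then show ?thesis using False by (simp add: runs_def m_def)
  qed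
  have "s mod 4 = 2" unfolding s_def by presburger
  then have "runs n s \<ge> 2" using i by (simp add: runs_def m_def s_def)
  moreover have "1 \<le> s" "s < e" by (auto simp: s_def e_def)
  moreover have "e \<le> n" using i m by (auto simp: s_def e_def)
  moreover have "s \<le> Suc b"
  proof -
    have "i \<le> (b - 1) div 4" by (simp add: i_def)
    then have "4 * i \<le> b - 1" by linarith
    then show ?thesis using b by (simp add: s_def)
  qed
  moreover have "b \<le> Suc e"
  proof (cases "i = m - 1")
    case True
    then show ?thesis using b by (simp add: e_def)
  next
    case False
    then have "i = (b - 1) div 4" by (simp add: i_def min_def split: if_splits)
    then show ?thesis using False by (simp add: e_def s_def)
  qed
  ultimately show "\<exists>s e. 1 \<le> s \<and> s < e \<and> e \<le> n \<and> s \<le> Suc b \<and> b \<le> Suc e \<and>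
    runs n s \<ge> 2 \<and> (\<forall>j. s < j \<and> j \<le> e \<longrightarrow> runs n j \<ge> 1)"
    using run by blast
qed

lemma sum_runs:
  assumes "3 \<le> n"
  shows "(\<Sum>b = 1..n. runs n b) = n - n div 4"
proof -
  define m where "m = Suc n div 4"
  have "(\<Sum>b<4 * k. if b mod 4 = 2 then 2 else of_bool (b mod 4 = 3)) = 3 * k" for k :: nat
  proof (induction k)
    case (Suc k)
    have "4 * Suc k = Suc (Suc (Suc (Suc (4 * k))))" by simp
    moreover have "(4 * k) mod 4 = 0" "Suc (4 * k) mod 4 = 1" "Suc (Suc (4 * k)) mod 4 = 2"
      "Suc (Suc (Suc (4 * k))) mod 4 = 3" by presburger+
    ultimately show ?case using Suc by (simp only: sum.lessThan_Suc) simp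
  qed simp
  then have "(\<Sum>b<4 * m. runs n b) = 3 * m" by (simp add: runs_def m_def)
  moreover have "(\<Sum>b = 4 * m..<Suc n. runs n b) = (\<Sum>b = 4 * m..<n. 1)"
    by (rule sum.mono_neutral_cong_right) (auto simp: runs_def m_def)
  moreover have "(\<Sum>b<4*m. runs n b) + (\<Sum>b = 4 * m..<Suc n. runs n b) = (\<Sum>b<Suc n. runs n b)"
    unfolding lessThan_atLeast0 by (rule sum.atLeastLessThan_concat) (auto simp: m_def)
  moreover have "(\<Sum>b<Suc n. runs n b) = (\<Sum>b = 1..n. runs n b)"
    using assms by (intro sum.mono_neutral_right) (auto simp: runs_def not_less_eq_eq)
  ultimately have "(\<Sum>b = 1..n. runs n b) = 3 * m + (n - 4 * m)" by simp
  also have "\<dots> = n - n div 4"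
  proof -
    define q d where "q = n div 4" and "d = n mod 4"
    have "m = q + of_bool (d = 3)" by (auto simp: m_def q_def d_def div_Suc mod_Suc)
    moreover have "n = 4 * q + d" by (simp add: q_def d_def)
    ultimately show ?thesis unfolding q_def[symmetric] by (cases "d = 3") simp_all
  qed
  finally show ?thesis .
qed

section \<open>The optimal pebbling numbers\<close>

lemma optimal_pebbling_number_eqI:
  assumes "pebbling_distribution G P" "solvable G P" "pebbling_size G P = s"
    and "\<And>Q. pebbling_distribution G Q \<Longrightarrow> solvable G Q \<Longrightarrow> s \<le> pebbling_size G Q"
  shows "\<pi>\<^sub>o\<^sub>p\<^sub>t G = s"
  unfolding optimal_pebbling_number_def
  using assms by (intro Least_equality) blast+

lemma optimal_pebbling_number_staircase_4:
  assumes "3 \<le> n"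
  shows "\<pi>\<^sub>o\<^sub>p\<^sub>t (staircase_graph 4 n) = n - n div 4"
proof (rule optimal_pebbling_number_eqI)
  show "pebbling_size (staircase_graph 4 n) (inner_distribution n (runs n)) = n - n div 4"
    unfolding pebbling_size_inner using assms by (rule sum_runs)
  fix Q assume "pebbling_distribution (staircase_graph 4 n) Q" "solvable (staircase_graph 4 n) Q"
  then show "n - n div 4 \<le> pebbling_size (staircase_graph 4 n) Q"
    using solvable_size_ge[of n Q] by linarith
qed (use assms in \<open>simp_all add: pebbling_distribution_inner solvable_runs\<close>)

lemma optimal_pebbling_number_staircase_4_1: "\<pi>\<^sub>o\<^sub>p\<^sub>t (staircase_graph 4 1) = 2"
proof (rule optimal_pebbling_number_eqI)
  let ?G = "staircase_graph 4 1"
  let ?P = "\<lambda>v. of_bool (v \<in> verts ?G)"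
  show "pebbling_distribution ?G ?P" by (simp add: pebbling_distribution_def)
  show "solvable ?G ?P"
    unfolding solvable_def pebbling_reachable_def by (intro ballI exI[of _ ?P]) auto
  have "lower 1 \<in> verts ?G" "upper 1 \<in> verts ?G" unfolding verts_cells by auto
  then show "pebbling_size ?G ?P = 2"
    by (simp add: pebbling_size_columns weight_def columns_def)
qed (rule solvable_size_ge_1)

lemma optimal_pebbling_number_staircase_4_2: "\<pi>\<^sub>o\<^sub>p\<^sub>t (staircase_graph 4 2) = 3"
proof (rule optimal_pebbling_number_eqI)
  let ?G = "staircase_graph 4 2" and ?P = "inner_distribution 2 (\<lambda>b. 3 - b)"
  show "pebbling_distribution ?G ?P" by (rule pebbling_distribution_inner)
  show "pebbling_size ?G ?P = 3" unfolding pebbling_size_inner by (simp add: numeral_2_eq_2)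
  show "solvable ?G ?P"
    by (rule solvable_of_runs) (intro exI[of _ 1] exI[of _ 2], auto)
qed (rule solvable_size_ge_2)

theorem theorem2p7:
  shows "(\<forall>k r n :: nat. r \<in> {0, 1, 2, 3} \<longrightarrow> n = 4 * k + r \<longrightarrow> n \<ge> 1 \<longrightarrow> n \<notin> {1, 2} \<longrightarrow>
            \<pi>\<^sub>o\<^sub>p\<^sub>t (staircase_graph 4 (4 * k + r)) = 3 * k + r) \<and>
         \<pi>\<^sub>o\<^sub>p\<^sub>t (staircase_graph 4 1) = 2 \<and>
         \<pi>\<^sub>o\<^sub>p\<^sub>t (staircase_graph 4 2) = 3"
proof (intro conjI allI impI)
  fix k r n :: nat
  assume r: "r \<in> {0, 1, 2, 3}" and "n = 4 * k + r" "n \<ge> 1" "n \<notin> {1, 2}"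
  then have "3 \<le> 4 * k + r" by auto
  moreover have "(4 * k + r) div 4 = k" using r by auto
  ultimately show "\<pi>\<^sub>o\<^sub>p\<^sub>t (staircase_graph 4 (4 * k + r)) = 3 * k + r"
    by (simp add: optimal_pebbling_number_staircase_4)
qed (rule optimal_pebbling_number_staircase_4_1 optimal_pebbling_number_staircase_4_2)+

end
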